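(* Let $\mathsf{JL}$ be a justification logic and $\mathcal{CS}$ a constant specification for $\mathsf{JL}$. Every formula occurring in a $\mathsf{JL}^{\mathcal T}_{\mathcal{CS}}$-tableau proof is a weak $\mathsf{JL}_{\mathcal{CS}}$-subformula of the root of the tableau.
   Context: Language. Justification terms are built from justification variables and constants using binary $\cdot,+$ and unary $!,\bar?,?$; subterms as usual ($s$ is a subterm of $s$, $s+t$, $t+s$, $s\cdot t$, $t\cdot s$, $!s$, $\bar?s$, $?s$, transitively). Formulas: $A ::= p \mid \bot \mid \neg A \mid A\to A \mid t:A$, $p$ from a countable set $\mathcal P$ of propositional variables. Logics. $\mathsf J$ has axiom schemes: all propositional tautologies; $s:A\to(s+t):A$, $s:A\to(t+s):A$; $s:(A\to B)\to(t:A\to(s\cdot t):B)$. Further schemes: jT: $t:A\to A$; jD: $t:\bot\to\bot$; j4: $t:A\to\,!t:t:A$; jB: $\neg A\to\bar{?}t:\neg t:A$; j5: $\neg t:A\to ?t:\neg t:A$. A justification logic $\mathsf{JL}$ is $\mathsf J$ plus any combination of these; its language contains $\cdot,+$ and those of $!,\bar?,?$ occurring in its axioms. A constant specification $\mathcal{CS}$ for $\mathsf{JL}$ is a downward closed set of formulas $c_{i_n}:\dots:c_{i_1}:A$ ($n\ge1$, constants $c_{i_j}$, $A$ an axiom instance of $\mathsf{JL}$): if $c_{i_n}:c_{i_{n-1}}:\dots:c_{i_1}:A\in\mathcal{CS}$, $n\ge2$, then $c_{i_{n-1}}:\dots:c_{i_1}:A\in\mathcal{CS}$. Subformulas. "$A$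 is a $\mathsf{JL}_{\mathcal{CS}}$-subformula of $B$" is the least relation such that: $A=B$; or $B=\neg F$ and $A$ is one of $F$; or $B=F\to G$ and $A$ is one of $F$ or of $G$; or $B=t:F$ and $A$ is one of $F$; or $A=t:F$ where $t$ is a subterm of a term occurring in $B$ and $F$ is one of $B$; or $A$ is one of some $c_{i_n}:\dots:c_{i_1}:F\in\mathcal{CS}$; closed under transitivity. $A$ is a weak $\mathsf{JL}_{\mathcal{CS}}$-subformula of $B$ if $A$ is a $\mathsf{JL}_{\mathcal{CS}}$-subformula of $B$ or the negation of one. $\mathsf{JL}^{\mathcal T}_{\mathcal{CS}}$-tableaux. A tableau for $F$ has root $\neg F$, extended by rule applications whose premises lie on the extended branch. Rules: $(F\neg)$: $\neg\neg A$ / $A$; $(F\to)$: $\neg(A\to B)$ / $A,\neg B$; $(T\to)$: $A\to B$ / $\neg A$ | $B$; $(F+_L)$: $\neg(t+s):A$ / $\neg t:A$; $(F+_R)$: $\neg(t+s):A$ / $\neg s:A$; $(T\cdot)$: from $s:(A\to B)$ and $t:A$ on the branch add $(s\cdot t):B$, provided all three are $\mathsf{JL}_{\mathcal{CS}}$-subformulas of the root; $(PB)$: split into $A$ | $\neg A$, provided $A$ is a $\mathsf{JL}_{\mathcal{CS}}$-subformula of the root. Additionally: with jT, $(T:)$: $t:A$ / $A$; with jD, $(T:_\bot)$: $t:\bot$ / $\bot$; with j4, $(F!)$: $\neg!t:t:A$ / $\neg t:A$; with jB, $(F\bar?)$: $\neg\bar?t:\neg t:A$ / $A$; with j5, $(F?)$: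 $\neg?t:\neg t:A$ / $t:A$. A branch closes if it contains $A$ and $\neg A$, or $\bot$, or $\neg c:F$ with $c:F\in\mathcal{CS}$; a tableau is closed if all branches close. A $\mathsf{JL}^{\mathcal T}_{\mathcal{CS}}$-tableau proof of $F$ is a closed $\mathsf{JL}^{\mathcal T}_{\mathcal{CS}}$-tableau with root $\neg F$. *)

theory Defs
  imports "HOL-Library.Countable"
begin

datatype ('v, 'c) tm =
    JVar 'v
  | JCon 'c
  | App "('v, 'c) tm" "('v, 'c) tm"  (infixl "\<^bold>\<cdot>" 95)
  | Plus "('v, 'c) tm" "('v, 'c) tm"  (infixl "\<^bold>+" 94)
  | Bang "('v, 'c) tm"
  | BarQuery "('v, 'c) tm"
  | Query "('v, 'c) tm"

inductive subterm :: "('v, 'c) tm \<Rightarrow> ('v, 'c) tm \<Rightarrow> bool" where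
  refl: "subterm s s"
| PlusL: "subterm s (s \<^bold>+ t)"
| PlusR: "subterm s (t \<^bold>+ s)"
| AppL: "subterm s (s \<^bold>\<cdot> t)"
| AppR: "subterm s (t \<^bold>\<cdot> s)"
| Bang: "subterm s (Bang s)"
| BarQuery: "subterm s (BarQuery s)"
| Query: "subterm s (Query s)"
| trans: "subterm r s \<Longrightarrow> subterm s t \<Longrightarrow> subterm r t"

datatype ('v, 'c, 'p) fm =
    Atom 'p
  | Falsum  ("\<^bold>\<bottom>")
  | Neg "('v, 'c, 'p) fm"  ("\<^bold>\<not> _" [80] 80)
  | Imp "('v, 'c, 'p) fm" "('v, 'c, 'p) fm"  (infixr "\<^bold>\<rightarrow>" 70)
  | Just "('v, 'c) tm" "('v, 'c, 'p) fm"  (infixr ":." 90)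

primrec terms_in :: "('v, 'c, 'p) fm \<Rightarrow> ('v, 'c) tm set" where
  "terms_in (Atom p) = {}"
| "terms_in \<^bold>\<bottom> = {}"
| "terms_in (\<^bold>\<not> A) = terms_in A"
| "terms_in (A \<^bold>\<rightarrow> B) = terms_in A \<union> terms_in B"
| "terms_in (t :. A) = insert t (terms_in A)"

text \<open>A justification logic is identified with the set of schemes it adds to the basic logic J.\<close>

datatype scheme = jT | jD | j4 | jB | j5

type_synonym logic = "scheme set"

text \<open>Terms and formulas are built from all operators; the language of a particular logic is
  singled out by the next two predicates.\<close>

primrec tm_of_lang :: "logic \<Rightarrow> ('v, 'c) tm \<Rightarrow> bool" where
  "tm_of_lang JL (JVar x) = True"
| "tm_of_lang JL (JCon c) = True"
| "tm_of_lang JL (s \<^bold>\<cdot> t) = (tm_of_lang JL s \<and> tm_of_lang JL t)"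
| "tm_of_lang JL (s \<^bold>+ t) = (tm_of_lang JL s \<and> tm_of_lang JL t)"
| "tm_of_lang JL (Bang t) = (j4 \<in> JL \<and> tm_of_lang JL t)"
| "tm_of_lang JL (BarQuery t) = (jB \<in> JL \<and> tm_of_lang JL t)"
| "tm_of_lang JL (Query t) = (j5 \<in> JL \<and> tm_of_lang JL t)"

primrec fm_of_lang :: "logic \<Rightarrow> ('v, 'c, 'p) fm \<Rightarrow> bool" where
  "fm_of_lang JL (Atom p) = True"
| "fm_of_lang JL \<^bold>\<bottom> = True"
| "fm_of_lang JL (\<^bold>\<not> A) = fm_of_lang JL A"
| "fm_of_lang JL (A \<^bold>\<rightarrow> B) = (fm_of_lang JL A \<and> fm_of_lang JL B)"
| "fm_of_lang JL (t :. A) = (tm_of_lang JL t \<and> fm_of_lang JL A)"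

text \<open>In propositional tautologies, formulas \<open>t :. A\<close> count as atomic; the valuation is
  therefore a function on formulas, consulted only at atoms and at such formulas.\<close>

primrec prop_eval :: "(('v, 'c, 'p) fm \<Rightarrow> bool) \<Rightarrow> ('v, 'c, 'p) fm \<Rightarrow> bool" where
  "prop_eval v (Atom p) = v (Atom p)"
| "prop_eval v \<^bold>\<bottom> = False"
| "prop_eval v (\<^bold>\<not> A) = (\<not> prop_eval v A)"
| "prop_eval v (A \<^bold>\<rightarrow> B) = (prop_eval v A \<longrightarrow> prop_eval v B)"
| "prop_eval v (t :. A) = v (t :. A)"

definition tautology :: "('v, 'c, 'p) fm \<Rightarrow> bool" where
  "tautology A \<longleftrightarrow> (\<forall>v. prop_eval v A)"

inductive scheme_instance :: "logic \<Rightarrow> ('v, 'c, 'p) fm \<Rightarrow> bool" for JL where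
  Taut: "tautology A \<Longrightarrow> scheme_instance JL A"
| SumL: "scheme_instance JL (s :. A \<^bold>\<rightarrow> (s \<^bold>+ t) :. A)"
| SumR: "scheme_instance JL (s :. A \<^bold>\<rightarrow> (t \<^bold>+ s) :. A)"
| Appl: "scheme_instance JL (s :. (A \<^bold>\<rightarrow> B) \<^bold>\<rightarrow> (t :. A \<^bold>\<rightarrow> (s \<^bold>\<cdot> t) :. B))"
| jT: "jT \<in> JL \<Longrightarrow> scheme_instance JL (t :. A \<^bold>\<rightarrow> A)"
| jD: "jD \<in> JL \<Longrightarrow> scheme_instance JL (t :. \<^bold>\<bottom> \<^bold>\<rightarrow> \<^bold>\<bottom>)"
| j4: "j4 \<in> JL \<Longrightarrow> scheme_instance JL (t :. A \<^bold>\<rightarrow> Bang t :. t :. A)"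
| jB: "jB \<in> JL \<Longrightarrow> scheme_instance JL (\<^bold>\<not> A \<^bold>\<rightarrow> BarQuery t :. (\<^bold>\<not> t :. A))"
| j5: "j5 \<in> JL \<Longrightarrow> scheme_instance JL (\<^bold>\<not> t :. A \<^bold>\<rightarrow> Query t :. (\<^bold>\<not> t :. A))"

definition axiom_instance :: "logic \<Rightarrow> ('v, 'c, 'p) fm \<Rightarrow> bool" where
  "axiom_instance JL A \<longleftrightarrow> fm_of_lang JL A \<and> scheme_instance JL A"

primrec const_prefix :: "'c list \<Rightarrow> ('v, 'c, 'p) fm \<Rightarrow> ('v, 'c, 'p) fm" where
  "const_prefix [] A = A"
| "const_prefix (c # cs) A = JCon c :. const_prefix cs A"

definition constant_specification :: "logic \<Rightarrow> ('v, 'c, 'p) fm set \<Rightarrow> bool" where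
  "constant_specification JL CS \<longleftrightarrow>
     (\<forall>X \<in> CS. \<exists>cs A. cs \<noteq> [] \<and> axiom_instance JL A \<and> X = const_prefix cs A) \<and>
     (\<forall>c cs A. cs \<noteq> [] \<and> axiom_instance JL A \<and> const_prefix (c # cs) A \<in> CS
        \<longrightarrow> const_prefix cs A \<in> CS)"

text \<open>\<open>subfm CS A B\<close> means that A is a subformula of B. If B and all members of CS belong to the
  language of a logic, then so does A, hence the relation needs no restriction to a language.\<close>

inductive subfm :: "('v, 'c, 'p) fm set \<Rightarrow> ('v, 'c, 'p) fm \<Rightarrow> ('v, 'c, 'p) fm \<Rightarrow> bool"
  for CS where
  refl: "subfm CS A A"
| Neg: "subfm CS A F \<Longrightarrow> subfm CS A (\<^bold>\<not> F)"
| ImpL: "subfm CS A F \<Longrightarrow> subfm CS A (F \<^bold>\<rightarrow> G)"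
| ImpR: "subfm CS A G \<Longrightarrow> subfm CS A (F \<^bold>\<rightarrow> G)"
| Just: "subfm CS A F \<Longrightarrow> subfm CS A (t :. F)"
| Term: "s \<in> terms_in B \<Longrightarrow> subterm t s \<Longrightarrow> subfm CS F B \<Longrightarrow> subfm CS (t :. F) B"
| CS: "X \<in> CS \<Longrightarrow> subfm CS A X \<Longrightarrow> subfm CS A B"
| trans: "subfm CS A B \<Longrightarrow> subfm CS B C \<Longrightarrow> subfm CS A C"

definition weak_subfm ::
  "('v, 'c, 'p) fm set \<Rightarrow> ('v, 'c, 'p) fm \<Rightarrow> ('v, 'c, 'p) fm \<Rightarrow> bool" where
  "weak_subfm CS A B \<longleftrightarrow> subfm CS A B \<or> (\<exists>C. A = \<^bold>\<not> C \<and> subfm CS C B)"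

datatype 'a tree = Node (root_label: 'a) (subtrees: "'a tree list")

text \<open>\<open>tableau_rule JL CS R \<Gamma> out\<close>: in a tableau with root formula R, a branch whose set of
  formulas is \<open>\<Gamma>\<close> may be extended by \<open>out\<close>, where each member of \<open>out\<close> lists the
  formulas added, in this order, along one new branch.\<close>

inductive tableau_rule ::
  "logic \<Rightarrow> ('v, 'c, 'p) fm set \<Rightarrow> ('v, 'c, 'p) fm \<Rightarrow> ('v, 'c, 'p) fm set \<Rightarrow>
   ('v, 'c, 'p) fm list list \<Rightarrow> bool"
  for JL CS R \<Gamma> where
  FNeg: "\<^bold>\<not> \<^bold>\<not> A \<in> \<Gamma> \<Longrightarrow> tableau_rule JL CS R \<Gamma> [[A]]"
| FImp: "\<^bold>\<not> (A \<^bold>\<rightarrow> B) \<in> \<Gamma> \<Longrightarrow> tableau_rule JL CS R \<Gamma> [[A, \<^bold>\<not> B]]"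
| TImp: "A \<^bold>\<rightarrow> B \<in> \<Gamma> \<Longrightarrow> tableau_rule JL CS R \<Gamma> [[\<^bold>\<not> A], [B]]"
| FPlusL: "\<^bold>\<not> (t \<^bold>+ s) :. A \<in> \<Gamma> \<Longrightarrow> tableau_rule JL CS R \<Gamma> [[\<^bold>\<not> t :. A]]"
| FPlusR: "\<^bold>\<not> (t \<^bold>+ s) :. A \<in> \<Gamma> \<Longrightarrow> tableau_rule JL CS R \<Gamma> [[\<^bold>\<not> s :. A]]"
| TApp: "s :. (A \<^bold>\<rightarrow> B) \<in> \<Gamma> \<Longrightarrow> t :. A \<in> \<Gamma> \<Longrightarrow>
    subfm CS (s :. (A \<^bold>\<rightarrow> B)) R \<Longrightarrow> subfm CS (t :. A) R \<Longrightarrow> subfm CS ((s \<^bold>\<cdot> t) :. B) R \<Longrightarrow>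
    tableau_rule JL CS R \<Gamma> [[(s \<^bold>\<cdot> t) :. B]]"
| PB: "subfm CS A R \<Longrightarrow> tableau_rule JL CS R \<Gamma> [[A], [\<^bold>\<not> A]]"
| TJust: "jT \<in> JL \<Longrightarrow> t :. A \<in> \<Gamma> \<Longrightarrow> tableau_rule JL CS R \<Gamma> [[A]]"
| TJustFalsum: "jD \<in> JL \<Longrightarrow> t :. \<^bold>\<bottom> \<in> \<Gamma> \<Longrightarrow> tableau_rule JL CS R \<Gamma> [[\<^bold>\<bottom>]]"
| FBang: "j4 \<in> JL \<Longrightarrow> \<^bold>\<not> Bang t :. t :. A \<in> \<Gamma> \<Longrightarrow> tableau_rule JL CS R \<Gamma> [[\<^bold>\<not> t :. A]]"
| FBarQuery: "jB \<in> JL \<Longrightarrow> \<^bold>\<not> BarQuery t :. (\<^bold>\<not> t :. A) \<in> \<Gamma> \<Longrightarrow> tableau_rule JL CS R \<Gamma> [[A]]"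
| FQuery: "j5 \<in> JL \<Longrightarrow> \<^bold>\<not> Query t :. (\<^bold>\<not> t :. A) \<in> \<Gamma> \<Longrightarrow> tableau_rule JL CS R \<Gamma> [[t :. A]]"

primrec chain :: "'a list \<Rightarrow> 'a tree list" where
  "chain [] = []"
| "chain (x # xs) = [Node x (chain xs)]"

text \<open>\<open>tableau_step JL CS R \<Gamma> T T'\<close>: the tree \<open>T'\<close> arises from \<open>T\<close> by one rule application at a
  leaf of \<open>T\<close>, where \<open>\<Gamma>\<close> is the set of formulas strictly above the root of \<open>T\<close>.\<close>

inductive tableau_step ::
  "logic \<Rightarrow> ('v, 'c, 'p) fm set \<Rightarrow> ('v, 'c, 'p) fm \<Rightarrow> ('v, 'c, 'p) fm set \<Rightarrow>
   ('v, 'c, 'p) fm tree \<Rightarrow> ('v, 'c, 'p) fm tree \<Rightarrow> bool"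
  for JL CS R where
  leaf: "tableau_rule JL CS R (insert A \<Gamma>) out \<Longrightarrow>
    tableau_step JL CS R \<Gamma> (Node A []) (Node A (concat (map chain out)))"
| below: "tableau_step JL CS R (insert A \<Gamma>) T T' \<Longrightarrow>
    tableau_step JL CS R \<Gamma> (Node A (Ts @ T # Us)) (Node A (Ts @ T' # Us))"

inductive tableau ::
  "logic \<Rightarrow> ('v, 'c, 'p) fm set \<Rightarrow> ('v, 'c, 'p) fm \<Rightarrow> ('v, 'c, 'p) fm tree \<Rightarrow> bool"
  for JL CS F where
  root: "tableau JL CS F (Node (\<^bold>\<not> F) [])"
| extend: "tableau JL CS F T \<Longrightarrow> tableau_step JL CS (\<^bold>\<not> F) {} T T' \<Longrightarrow> tableau JL CS F T'"

inductive branch :: "'a tree \<Rightarrow> 'a list \<Rightarrow> bool" where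
  leaf: "branch (Node A []) [A]"
| node: "T \<in> set Ts \<Longrightarrow> branch T b \<Longrightarrow> branch (Node A Ts) (A # b)"

definition closed_branch :: "('v, 'c, 'p) fm set \<Rightarrow> ('v, 'c, 'p) fm list \<Rightarrow> bool" where
  "closed_branch CS b \<longleftrightarrow>
     (\<exists>A. A \<in> set b \<and> \<^bold>\<not> A \<in> set b) \<or>
     \<^bold>\<bottom> \<in> set b \<or>
     (\<exists>c F. \<^bold>\<not> JCon c :. F \<in> set b \<and> JCon c :. F \<in> CS)"

definition closed_tableau :: "('v, 'c, 'p) fm set \<Rightarrow> ('v, 'c, 'p) fm tree \<Rightarrow> bool" where
  "closed_tableau CS T \<longleftrightarrow> (\<forall>b. branch T b \<longrightarrow> closed_branch CS b)"

definition tableau_proof ::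
  "logic \<Rightarrow> ('v, 'c, 'p) fm set \<Rightarrow> ('v, 'c, 'p) fm \<Rightarrow> ('v, 'c, 'p) fm tree \<Rightarrow> bool" where
  "tableau_proof JL CS F T \<longleftrightarrow> tableau JL CS F T \<and> closed_tableau CS T"

end

theory Submission
  imports Defs
begin

text \<open>Every rule leads from weak subformulas of the root to weak subformulas of the root. For \<open>TApp\<close>
  and \<open>PB\<close> this is their side condition, for the sum rules it is the clause of the subformula
  relation that replaces a justification term by a subterm. The remaining rules pass to parts of the
  premise: the premise of a T-rule is no negation, hence itself a subformula of the root, and a
  negation \<open>\<^bold>\<not> A\<close> is a weak subformula only if \<open>A\<close> is a subformula.\<close>

lemma weak_subfmI: "subfm CS A B \<Longrightarrow> weak_subfm CS A B"
  by (simp add: weak_subfm_def)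

lemma weak_subfm_NegI: "subfm CS A B \<Longrightarrow> weak_subfm CS (\<^bold>\<not> A) B"
  by (simp add: weak_subfm_def)

text \<open>Transitivity is itself a clause of \<open>subfm\<close>, so passing to parts of a
  subformula needs no inversion of the relation: the part is a subformula of the whole.\<close>

lemma subfm_NegD: "subfm CS (\<^bold>\<not> A) B \<Longrightarrow> subfm CS A B"
  by (rule subfm.trans[OF subfm.Neg[OF subfm.refl]])

lemma subfm_ImpD:
  assumes "subfm CS (A \<^bold>\<rightarrow> B) C"
  shows "subfm CS A C" and "subfm CS B C"
  using subfm.trans[OF subfm.ImpL[OF subfm.refl] assms]
    subfm.trans[OF subfm.ImpR[OF subfm.refl] assms] .

lemma subfm_JustD: "subfm CS (t :. A) B \<Longrightarrow> subfm CS A B"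
  by (rule subfm.trans[OF subfm.Just[OF subfm.refl]])

text \<open>The term \<open>s\<close> occurs in \<open>s :. A\<close> itself, so the clause
  \<open>Term\<close> applies with \<open>s :. A\<close> as the ambient formula; transitivity then
  leads to \<open>B\<close>.\<close>

lemma subfm_subterm:
  assumes "subfm CS (s :. A) B" and "subterm t s"
  shows "subfm CS (t :. A) B"
proof -
  have "subfm CS (t :. A) (s :. A)"
    by (rule subfm.Term[OF _ assms(2) subfm.Just[OF subfm.refl]]) simp
  then show ?thesis
    using assms(1) by (rule subfm.trans)
qed

text \<open>Either the negation is itself a subformula, which leads down to \<open>A\<close>, or it
  is the negation of a subformula, which must be \<open>A\<close> by injectivity.\<close>

lemma weak_subfm_NegD: "weak_subfm CS (\<^bold>\<not> A) B \<Longrightarrow> subfm CS A B"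
  by (auto simp: weak_subfm_def dest: subfm_NegD)

lemma weak_subfm_ImpD: "weak_subfm CS (A \<^bold>\<rightarrow> B) C \<Longrightarrow> subfm CS (A \<^bold>\<rightarrow> B) C"
  by (simp add: weak_subfm_def)

lemma weak_subfm_JustD: "weak_subfm CS (t :. A) B \<Longrightarrow> subfm CS (t :. A) B"
  by (simp add: weak_subfm_def)

lemma tableau_rule_weak_subfm:
  assumes "tableau_rule JL CS R \<Gamma> out"
    and "\<And>A. A \<in> \<Gamma> \<Longrightarrow> weak_subfm CS A R"
    and "xs \<in> set out" and "A \<in> set xs"
  shows "weak_subfm CS A R"
  using assms
proof (induction rule: tableau_rule.induct)
  case (FNeg B)
  have "subfm CS (\<^bold>\<not> B) R"
    by (rule weak_subfm_NegD[OF FNeg.prems(1)[OF FNeg.hyps]])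
  from subfm_NegD[OF this] FNeg.prems(2,3) show ?case by (auto intro: weak_subfmI)
next
  case (FImp B C)
  have "subfm CS (B \<^bold>\<rightarrow> C) R"
    by (rule weak_subfm_NegD[OF FImp.prems(1)[OF FImp.hyps]])
  from subfm_ImpD[OF this] FImp.prems(2,3) show ?case by (auto intro: weak_subfmI weak_subfm_NegI)
next
  case (TImp B C)
  have "subfm CS (B \<^bold>\<rightarrow> C) R"
    by (rule weak_subfm_ImpD[OF TImp.prems(1)[OF TImp.hyps]])
  from subfm_ImpD[OF this] TImp.prems(2,3) show ?case by (auto intro: weak_subfmI weak_subfm_NegI)
next
  case (FPlusL t s B)
  have "subfm CS ((t \<^bold>+ s) :. B) R"
    by (rule weak_subfm_NegD[OF FPlusL.prems(1)[OF FPlusL.hyps]])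
  then have "subfm CS (t :. B) R" by (rule subfm_subterm) (rule subterm.PlusL)
  with FPlusL.prems(2,3) show ?case by (auto intro: weak_subfm_NegI)
next
  case (FPlusR t s B)
  have "subfm CS ((t \<^bold>+ s) :. B) R"
    by (rule weak_subfm_NegD[OF FPlusR.prems(1)[OF FPlusR.hyps]])
  then have "subfm CS (s :. B) R" by (rule subfm_subterm) (rule subterm.PlusR)
  with FPlusR.prems(2,3) show ?case by (auto intro: weak_subfm_NegI)
next
  case (TApp s B C t)
  \<comment> \<open>\<open>hyps(5)\<close> is the side condition on the conclusion, whose product
    term is built from two separate premises.\<close>
  from TApp.prems(2,3) TApp.hyps(5) show ?case by (auto intro: weak_subfmI)
next
  case (PB B)
  from PB.prems(2,3) PB.hyps show ?case by (auto intro: weak_subfmI weak_subfm_NegI)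
next
  case (TJust t B)
  have "subfm CS (t :. B) R"
    by (rule weak_subfm_JustD[OF TJust.prems(1)[OF TJust.hyps(2)]])
  from subfm_JustD[OF this] TJust.prems(2,3) show ?case by (auto intro: weak_subfmI)
next
  case (TJustFalsum t)
  have "subfm CS (t :. \<^bold>\<bottom>) R"
    by (rule weak_subfm_JustD[OF TJustFalsum.prems(1)[OF TJustFalsum.hyps(2)]])
  from subfm_JustD[OF this] TJustFalsum.prems(2,3) show ?case by (auto intro: weak_subfmI)
next
  case (FBang t B)
  have "subfm CS (Bang t :. t :. B) R"
    by (rule weak_subfm_NegD[OF FBang.prems(1)[OF FBang.hyps(2)]])
  from subfm_JustD[OF this] FBang.prems(2,3) show ?case by (auto intro: weak_subfm_NegI)
next
  case (FBarQuery t B)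
  have "subfm CS (BarQuery t :. (\<^bold>\<not> t :. B)) R"
    by (rule weak_subfm_NegD[OF FBarQuery.prems(1)[OF FBarQuery.hyps(2)]])
  from subfm_JustD[OF subfm_NegD[OF subfm_JustD[OF this]]] FBarQuery.prems(2,3) show ?case
    by (auto intro: weak_subfmI)
next
  case (FQuery t B)
  have "subfm CS (Query t :. (\<^bold>\<not> t :. B)) R"
    by (rule weak_subfm_NegD[OF FQuery.prems(1)[OF FQuery.hyps(2)]])
  from subfm_NegD[OF subfm_JustD[OF this]] FQuery.prems(2,3) show ?case by (auto intro: weak_subfmI)
qed

text \<open>\<open>chain\<close> returns a list of at most one tree, empty for an empty list of
  formulas; hence the union.\<close>

lemma set_tree_chain: "(\<Union>T \<in> set (chain xs). set_tree T) = set xs"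
  by (induction xs) simp_all

text \<open>The premises of a rule may lie above the subtree being extended, so the invariant must
  also cover \<open>\<Gamma>\<close>.\<close>

lemma tableau_step_weak_subfm:
  assumes "tableau_step JL CS R \<Gamma> T T'"
    and "\<And>A. A \<in> \<Gamma> \<Longrightarrow> weak_subfm CS A R"
    and "\<And>A. A \<in> set_tree T \<Longrightarrow> weak_subfm CS A R"
    and "A \<in> set_tree T'"
  shows "weak_subfm CS A R"
  using assms
proof (induction arbitrary: A rule: tableau_step.induct)
  case (leaf B \<Gamma> out)
  show ?case
  proof (cases "A = B")
    case True
    then show ?thesis using leaf.prems(2) by simp
  next
    case False
    with leaf.prems(3) obtain xs where "xs \<in> set out" "A \<in> (\<Union>T \<in> set (chain xs). set_tree T)"
      by auto
    then have "xs \<in> set out" "A \<in> set xs"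
      by (simp_all only: set_tree_chain)
    moreover have "weak_subfm CS C R" if "C \<in> insert B \<Gamma>" for C
      using that leaf.prems(1)[of C] leaf.prems(2)[of B] by auto
    ultimately show ?thesis
      using tableau_rule_weak_subfm[OF leaf.hyps] by simp
  qed
next
  case (below B \<Gamma> T T' Ts Us)
  \<comment> \<open>On descending into \<open>T\<close>, the label \<open>B\<close> joins the
    formulas above the subtree.\<close>
  have \<Gamma>: "weak_subfm CS C R" if "C \<in> insert B \<Gamma>" for C
    using that below.prems(1)[of C] below.prems(2)[of B] by auto
  have T: "weak_subfm CS C R" if "C \<in> set_tree T" for C
    by (rule below.prems(2)) (simp add: that)
  have T': "weak_subfm CS C R" if "C \<in> set_tree T'" for C
    using below.IH[OF \<Gamma> T that] .
  \<comment> \<open>Outside \<open>T'\<close> only the label \<open>B\<close> and the siblings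
    remain, all present in the old tree.\<close>
  from below.prems(3) consider "A \<in> set_tree T'" | "A \<in> set_tree (Node B (Ts @ T # Us))"
    by auto
  then show ?case
    by cases (rule T', assumption, rule below.prems(2))
qed

text \<open>A step only adds nodes below a leaf, so the initial label persists.\<close>

lemma root_label_tableau: "tableau JL CS F T \<Longrightarrow> root_label T = \<^bold>\<not> F"
  by (induction rule: tableau.induct) (auto elim: tableau_step.cases)

lemma tableau_weak_subfm:
  assumes "tableau JL CS F T" and "A \<in> set_tree T"
  shows "weak_subfm CS A (\<^bold>\<not> F)"
  using assms
proof (induction arbitrary: A rule: tableau.induct)
  case root
  then show ?case by (simp add: weak_subfmI subfm.refl)
next
  case (extend T T')
  show ?case
    \<comment> \<open>No formula lies above the root, so the condition on \<open>\<Gamma>\<close> is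
      vacuous.\<close>
    using tableau_step_weak_subfm[OF extend.hyps(2) _ extend.IH extend.prems] by simp
qed

theorem theorem8:
  fixes JL :: logic
    and CS :: "('v, 'c, 'p::countable) fm set"
    and F A :: "('v, 'c, 'p) fm"
    and T :: "('v, 'c, 'p) fm tree"
  assumes "constant_specification JL CS"
    and "fm_of_lang JL F"
    and "tableau_proof JL CS F T"
    and "A \<in> set_tree T"
  shows "weak_subfm CS A (root_label T)"
proof -
  have "tableau JL CS F T"
    using assms(3) by (simp add: tableau_proof_def)
  then show ?thesis
    using tableau_weak_subfm root_label_tableau assms(4) by fastforce
qed

end
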